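(* Assume $A_{11}=0$. Then the local truncation error of the ROE scheme $$\frac{f^i_{j,n+1}-f^i_{j,n}}{\Delta t}+\frac{\lambda_i}{2\Delta x}(f^i_{j+1,n}-f^i_{j-1,n})-\frac{|\lambda_i|}{2\Delta x}(f^i_{j+1,n}-2f^i_{j,n}+f^i_{j-1,n})$$ $$=\frac{M_i(u_{j-1,n})+2M_i(u_{j,n})+M_i(u_{j+1,n})}{4}+\frac{\mathrm{sgn}(\lambda_i)}{4}\big(M_i(u_{j-1,n})-M_i(u_{j+1,n})\big)-\frac{f^i_{j-1,n}+2f^i_{j,n}+f^i_{j+1,n}}{4}-\frac{\mathrm{sgn}(\lambda_i)}{4}\big(f^i_{j-1,n}-f^i_{j+1,n}\big),$$ $i=1,\dots,m$, with fixed ratio $\rho=\Delta t/\Delta x$, satisfies, as $t\to+\infty$, $\mathcal{T}_u=O(\Delta x\,t^{-2})+O(\Delta x^2t^{-3/2})$ and $\mathcal{T}_{\tilde Z}=O(\Delta x\,t^{-2})+O(\Delta x^2t^{-3/2})$.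
   Context: Same setting as Theorem 3.1: BGK system $\partial_tf^i+\lambda_i\partial_xf^i=M_i(u)-f^i$ with $u=\sum_if^i$, Condition ED, the matrix $D$ with $D_{11}=I_k$, $D_{12}=(I_k\cdots I_k)$ transforming to $Z=Df=(u,\tilde Z)$ solving $\partial_tZ+A\partial_xZ=-Z+DM(u)$ with $A=D\Lambda D^{-1}$ symmetric; $A_{11}$ is the top-left $k\times k$ block of $A$ (which equals $\sum_i\lambda_ih_i^{-1}$ where $D^TD=\mathrm{diag}(h_1,\dots,h_m)$). The truncation error is the residual of the scheme on the exact smooth solution, transformed by $D$: $(\mathcal{T}_u,\mathcal{T}_{\tilde Z})=D(\mathcal{T}^1,\dots,\mathcal{T}^m)$. The exact solution is the global smooth solution from small smooth initial data and satisfies the decay estimates $\|\partial_x^\beta Z\|_{L^\infty}\lesssim t^{-1/2-\beta/2}$, $\|\partial_x^\beta\tilde Z\|_{L^\infty}\lesssim t^{-1-\beta/2}$, $\|\partial_x^\beta Z_t\|_{L^\infty}\lesssim t^{-1-\beta/2}$, $\|\partial_x^\beta\tilde Z_t\|_{L^\infty}\lesssim t^{-3/2-\beta/2}$, and, when $A_{11}=0$, $\|u_{tt}\|,\|u_{tx}\|,\|\tilde Z_t\|,\|\tilde Z_{tt}\|\lesssim t^{-2}$. *)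

theory Defs
  imports "HOL-Analysis.Analysis"
begin

text \<open>Partial derivatives of a function g(t,x) of time t and space x.\<close>

definition pdx :: "(real \<Rightarrow> real \<Rightarrow> 'a::real_normed_vector) \<Rightarrow> real \<Rightarrow> real \<Rightarrow> 'a" where
  "pdx g t x = vector_derivative (\<lambda>y. g t y) (at x)"

definition pdt :: "(real \<Rightarrow> real \<Rightarrow> 'a::real_normed_vector) \<Rightarrow> real \<Rightarrow> real \<Rightarrow> 'a" where
  "pdt g t x = vector_derivative (\<lambda>s. g s x) (at t)"

text \<open>Iterated partial derivative along a word: True = d/dt, False = d/dx
  (the head of the list is applied last).\<close>

fun pDw :: "bool list \<Rightarrow> (real \<Rightarrow> real \<Rightarrow> 'a::real_normed_vector) \<Rightarrow> real \<Rightarrow> real \<Rightarrow> 'a" where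
  "pDw [] g = g"
| "pDw (b # w) g = (if b then pdt (pDw w g) else pdx (pDw w g))"

text \<open>The mixed partial derivative d_t^p d_x^q g.\<close>

definition pD :: "nat \<Rightarrow> nat \<Rightarrow> (real \<Rightarrow> real \<Rightarrow> 'a::real_normed_vector) \<Rightarrow> real \<Rightarrow> real \<Rightarrow> 'a" where
  "pD p q g = (pdt ^^ p) ((pdx ^^ q) g)"

text \<open>Smoothness (C-infinity) on the half plane t > 0: all iterated partial derivatives
  exist and are jointly continuous.\<close>

definition smooth_tx :: "(real \<Rightarrow> real \<Rightarrow> 'a::real_normed_vector) \<Rightarrow> bool" where
  "smooth_tx g \<longleftrightarrow>
     (\<forall>w. continuous_on ({0<..} \<times> UNIV) (\<lambda>(t, x). pDw w g t x)
        \<and> (\<forall>t>0. \<forall>x. (\<lambda>y. pDw w g t y) differentiable (at x)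
                     \<and> (\<lambda>s. pDw w g s x) differentiable (at t)))"

text \<open>Local truncation error of the ROE scheme (component i), evaluated on the function
  f = (f^1,...,f^m), with u = sum_i f^i, space step dx, time step dt, at the point (t,x).\<close>

definition roe_trunc ::
  "(nat \<Rightarrow> real) \<Rightarrow> (nat \<Rightarrow> real^'k \<Rightarrow> real^'k) \<Rightarrow> nat \<Rightarrow> (nat \<Rightarrow> real \<Rightarrow> real \<Rightarrow> real^'k)
    \<Rightarrow> real \<Rightarrow> real \<Rightarrow> nat \<Rightarrow> real \<Rightarrow> real \<Rightarrow> real^'k" where
  "roe_trunc lam M m f dx dt i t x =
    (let u = (\<lambda>s y. \<Sum>l<m. f l s y);
         fm = f i t (x - dx); f0 = f i t x; fp = f i t (x + dx);
         Mm = M i (u t (x - dx)); M0 = M i (u t x); Mp = M i (u t (x + dx))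
     in (1 / dt) *\<^sub>R (f i (t + dt) x - f0)
        + (lam i / (2 * dx)) *\<^sub>R (fp - fm)
        - (\<bar>lam i\<bar> / (2 * dx)) *\<^sub>R (fp - 2 *\<^sub>R f0 + fm)
        - ( (1/4) *\<^sub>R (Mm + 2 *\<^sub>R M0 + Mp)
          + (sgn (lam i) / 4) *\<^sub>R (Mm - Mp)
          - (1/4) *\<^sub>R (fm + 2 *\<^sub>R f0 + fp)
          - (sgn (lam i) / 4) *\<^sub>R (fm - fp)))"

end

theory Submission
  imports Defs
begin

(* Consistency of the ROE scheme for the BGK system in the case A_11 = 0.

   The proof has three layers.
   1. One-variable calculus: mean value and second-order Taylor bounds for
      vector-valued functions, and the resulting bounds for central, second and
      trapezoidal differences in terms of a bound on the third derivative.
   2. A single-component consistency estimate: if g is smooth and solves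
      g_t + lam g_x = Q - g, the ROE residual of g is bounded by
      B (dt + dx + 2 |lam| dx^2), where B bounds g_tt, g_tx and g_xxx.  The proof
      rewrites the residual exactly as a combination of Taylor remainders.
   3. Decay transfer: since D^T D = diag(h_1,...,h_m), every f^i is a fixed linear
      combination of the components of Z = D f, so the t^{-2} decay of Z_tt, Z_tx
      and Z_xxx (available when A_11 = 0) passes to every f^i.
   With dt = rho dx the residual is then O(dx t^{-2}); mapping it back by D gives the
   theorem.  The hypothesis A_11 = 0 enters
   only through the extra t^{-2} decay estimates it provides, which are assumed. *)

text \<open>Mean value inequality on an interval, for vector-valued functions.\<close>

lemma mean_value_bound:
  fixes \<phi> \<phi>' :: "real \<Rightarrow> 'a::real_normed_vector"
  assumes ab: "a \<le> b"
    and d: "\<And>y. y \<in> {a..b} \<Longrightarrow> (\<phi> has_vector_derivative \<phi>' y) (at y)"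
    and B: "\<And>y. y \<in> {a..b} \<Longrightarrow> norm (\<phi>' y) \<le> B"
  shows "norm (\<phi> b - \<phi> a) \<le> B * (b - a)"
proof -
  have "norm (\<phi> b - \<phi> a) \<le> B * norm (b - a)"
  proof (rule differentiable_bound[where S="{a..b}" and f'="\<lambda>y h. h *\<^sub>R \<phi>' y"])
    fix y assume y: "y \<in> {a..b}"
    show "(\<phi> has_derivative (\<lambda>h. h *\<^sub>R \<phi>' y)) (at y within {a..b})"
      using d[OF y] unfolding has_vector_derivative_def by (rule has_derivative_at_withinI)
    have "onorm (\<lambda>h. h *\<^sub>R \<phi>' y) = norm (\<phi>' y)"
      using onorm_scaleR_left[of "\<lambda>h::real. h" "\<phi>' y"] by (simp add: onorm_id)
    then show "onorm (\<lambda>h. h *\<^sub>R \<phi>' y) \<le> B" using B[OF y] by simp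
  qed (use ab in auto)
  then show ?thesis using ab by simp
qed

text \<open>The same inequality for functions differentiable everywhere, in either direction.\<close>

lemma mean_value_bound_abs:
  fixes \<phi> \<phi>' :: "real \<Rightarrow> 'a::real_normed_vector"
  assumes d: "\<And>y. (\<phi> has_vector_derivative \<phi>' y) (at y)"
    and B: "\<And>y. norm (\<phi>' y) \<le> B"
  shows "norm (\<phi> b - \<phi> a) \<le> B * \<bar>b - a\<bar>"
proof (cases "a \<le> b")
  case True
  then show ?thesis using mean_value_bound[of a b \<phi> \<phi>' B] d B by auto
next
  case False
  then have "norm (\<phi> a - \<phi> b) \<le> B * (a - b)" using mean_value_bound[of b a \<phi> \<phi>' B] d B by auto
  then show ?thesis using False by (simp add: norm_minus_commute)
qed

text \<open>Second-order Taylor bound: the first-order expansion is accurate up to B (b - a)^2.\<close>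

lemma taylor2_bound:
  fixes \<phi> \<phi>' \<phi>'' :: "real \<Rightarrow> 'a::real_normed_vector"
  assumes ab: "a \<le> b"
    and d1: "\<And>y. y \<in> {a..b} \<Longrightarrow> (\<phi> has_vector_derivative \<phi>' y) (at y)"
    and d2: "\<And>y. y \<in> {a..b} \<Longrightarrow> (\<phi>' has_vector_derivative \<phi>'' y) (at y)"
    and B: "\<And>y. y \<in> {a..b} \<Longrightarrow> norm (\<phi>'' y) \<le> B"
  shows "norm (\<phi> b - \<phi> a - (b - a) *\<^sub>R \<phi>' a) \<le> B * (b - a)^2"
proof -
  have B0: "0 \<le> B" using B[of a] ab by (meson atLeastAtMost_iff norm_ge_zero order.trans order_refl)
  have slope: "norm (\<phi>' y - \<phi>' a) \<le> B * (b - a)" if y: "y \<in> {a..b}" for y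
  proof -
    have "norm (\<phi>' y - \<phi>' a) \<le> B * (y - a)"
      by (rule mean_value_bound[where \<phi>'="\<phi>''"]) (use y d2 B in auto)
    also have "\<dots> \<le> B * (b - a)" using y B0 by (intro mult_left_mono) auto
    finally show ?thesis .
  qed
  have "norm ((\<lambda>y. \<phi> y - \<phi> a - (y - a) *\<^sub>R \<phi>' a) b - (\<lambda>y. \<phi> y - \<phi> a - (y - a) *\<^sub>R \<phi>' a) a)
      \<le> (B * (b - a)) * (b - a)"
  proof (rule mean_value_bound[where \<phi>'="\<lambda>y. \<phi>' y - \<phi>' a"])
    fix y assume y: "y \<in> {a..b}"
    show "((\<lambda>y. \<phi> y - \<phi> a - (y - a) *\<^sub>R \<phi>' a) has_vector_derivative \<phi>' y - \<phi>' a) (at y)"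
      by (rule has_vector_derivative_eq_rhs, (rule derivative_intros d1[OF y])+) simp
  qed (use ab slope in auto)
  then show ?thesis by (simp add: power2_eq_square mult.assoc)
qed

text \<open>A bound on all short forward difference quotients bounds the derivative.\<close>

lemma derivative_bound_from_differences:
  fixes \<psi> :: "real \<Rightarrow> 'a::real_normed_vector"
  assumes d: "(\<psi> has_vector_derivative v) (at t)"
    and K: "\<And>h. 0 < h \<Longrightarrow> h < 1 \<Longrightarrow> norm (\<psi> (t + h) - \<psi> t) \<le> K * h"
  shows "norm v \<le> K"
proof (rule field_le_epsilon)
  fix e :: real assume e: "0 < e"
  have "((\<lambda>h. norm (\<psi> (t + h) - \<psi> t - h *\<^sub>R v) / norm h) \<longlongrightarrow> 0) (at 0)"
    using d unfolding has_vector_derivative_def has_derivative_at by blast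
  then have "eventually (\<lambda>h. norm (norm (\<psi> (t + h) - \<psi> t - h *\<^sub>R v) / norm h) < e) (at 0)"
    using e by (auto simp: tendsto_iff dist_norm)
  then obtain d where d0: "0 < d" and dd: "\<And>h. h \<noteq> 0 \<Longrightarrow> dist h 0 < d \<Longrightarrow>
      norm (norm (\<psi> (t + h) - \<psi> t - h *\<^sub>R v) / norm h) < e"
    unfolding eventually_at by blast
  define h where "h = min (d/2) (1/2)"
  have h0: "0 < h" "h < 1" "h < d" using d0 by (auto simp: h_def)
  have "norm (\<psi> (t + h) - \<psi> t - h *\<^sub>R v) / h < e"
    using dd[of h] h0 by auto
  then have rem: "norm (\<psi> (t + h) - \<psi> t - h *\<^sub>R v) \<le> e * h" using h0 by (simp add: divide_less_eq)
  have "h * norm v = norm (h *\<^sub>R v)" using h0 by simp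
  also have "\<dots> \<le> norm (\<psi> (t + h) - \<psi> t) + norm (\<psi> (t + h) - \<psi> t - h *\<^sub>R v)"
    by (metis add.commute diff_diff_eq2 diff_add_cancel norm_triangle_ineq4)
  also have "\<dots> \<le> K * h + e * h" using K[OF h0(1,2)] rem by simp
  finally have "h * norm v \<le> h * (K + e)" by (simp add: algebra_simps)
  then show "norm v \<le> K + e" using h0 by simp
qed

text \<open>Chain rule for the reflected shifts y \<mapsto> F (x + y) and y \<mapsto> F (x - y).\<close>

lemma has_vector_derivative_shift_plus:
  assumes "\<And>z. (F has_vector_derivative F' z) (at z)"
  shows "((\<lambda>y. F (x + y)) has_vector_derivative F' (x + y)) (at y)"
proof -
  have "((F \<circ> (\<lambda>y. x + y)) has_vector_derivative (1 *\<^sub>R F' (x + y))) (at y)"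
    by (rule vector_diff_chain_at) (auto intro!: derivative_eq_intros assms)
  then show ?thesis by (simp add: o_def)
qed

lemma has_vector_derivative_shift_minus:
  assumes "\<And>z. (F has_vector_derivative F' z) (at z)"
  shows "((\<lambda>y. F (x - y)) has_vector_derivative - F' (x - y)) (at y)"
proof -
  have "((F \<circ> (\<lambda>y. x - y)) has_vector_derivative ((-1) *\<^sub>R F' (x - y))) (at y)"
    by (rule vector_diff_chain_at) (auto intro!: derivative_eq_intros assms)
  then show ?thesis by (simp add: o_def)
qed

text \<open>Second difference: |\<psi>(x+r) + \<psi>(x-r) - 2\<psi>(x)| \<le> 2 B r^2 when |\<psi>''| \<le> B.\<close>

lemma second_difference_bound:
  fixes \<psi> \<psi>' \<psi>'' :: "real \<Rightarrow> 'a::real_normed_vector"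
  assumes d1: "\<And>z. (\<psi> has_vector_derivative \<psi>' z) (at z)"
    and d2: "\<And>z. (\<psi>' has_vector_derivative \<psi>'' z) (at z)"
    and B: "\<And>z. norm (\<psi>'' z) \<le> B" and r: "0 \<le> r"
  shows "norm (\<psi> (x + r) + \<psi> (x - r) - 2 *\<^sub>R \<psi> x) \<le> 2 * B * r^2"
proof -
  have "norm ((\<lambda>y. \<psi> (x + y) + \<psi> (x - y) - 2 *\<^sub>R \<psi> x) r - (\<lambda>y. \<psi> (x + y) + \<psi> (x - y) - 2 *\<^sub>R \<psi> x) 0
      - (r - 0) *\<^sub>R (\<psi>' (x + 0) - \<psi>' (x - 0))) \<le> (2 * B) * (r - 0)^2"
  proof (rule taylor2_bound[where \<phi>'="\<lambda>y. \<psi>' (x + y) - \<psi>' (x - y)" and \<phi>''="\<lambda>y. \<psi>'' (x + y) + \<psi>'' (x - y)"])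
    fix y
    show "((\<lambda>y. \<psi> (x + y) + \<psi> (x - y) - 2 *\<^sub>R \<psi> x) has_vector_derivative \<psi>' (x + y) - \<psi>' (x - y)) (at y)"
      by (rule has_vector_derivative_eq_rhs,
          (rule has_vector_derivative_diff has_vector_derivative_add derivative_intros
                has_vector_derivative_shift_plus[OF d1] has_vector_derivative_shift_minus[OF d1])+) simp
    show "((\<lambda>y. \<psi>' (x + y) - \<psi>' (x - y)) has_vector_derivative \<psi>'' (x + y) + \<psi>'' (x - y)) (at y)"
      by (rule has_vector_derivative_eq_rhs, rule has_vector_derivative_diff,
          rule has_vector_derivative_shift_plus[OF d2], rule has_vector_derivative_shift_minus[OF d2]) simp
    show "norm (\<psi>'' (x + y) + \<psi>'' (x - y)) \<le> 2 * B"
      using norm_triangle_ineq[of "\<psi>'' (x + y)" "\<psi>'' (x - y)"] B[of "x + y"] B[of "x - y"] by simp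
  qed (use r in auto)
  then show ?thesis by (simp add: scaleR_2)
qed

text \<open>Central difference: |\<phi>(x+r) - \<phi>(x-r) - 2r\<phi>'(x)| \<le> 2 B r^3 when |\<phi>'''| \<le> B.\<close>

lemma central_difference_bound:
  fixes \<phi> \<phi>' \<phi>'' \<phi>''' :: "real \<Rightarrow> 'a::real_normed_vector"
  assumes d1: "\<And>z. (\<phi> has_vector_derivative \<phi>' z) (at z)"
    and d2: "\<And>z. (\<phi>' has_vector_derivative \<phi>'' z) (at z)"
    and d3: "\<And>z. (\<phi>'' has_vector_derivative \<phi>''' z) (at z)"
    and B: "\<And>z. norm (\<phi>''' z) \<le> B" and r: "0 \<le> r"
  shows "norm (\<phi> (x + r) - \<phi> (x - r) - (2 * r) *\<^sub>R \<phi>' x) \<le> 2 * B * r^3"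
proof -
  have B0: "0 \<le> B" using B[of 0] by (meson norm_ge_zero order.trans)
  have "norm ((\<lambda>y. \<phi> (x + y) - \<phi> (x - y) - (2 * y) *\<^sub>R \<phi>' x) r
      - (\<lambda>y. \<phi> (x + y) - \<phi> (x - y) - (2 * y) *\<^sub>R \<phi>' x) 0) \<le> (2 * B * r^2) * (r - 0)"
  proof (rule mean_value_bound[where \<phi>'="\<lambda>y. \<phi>' (x + y) + \<phi>' (x - y) - 2 *\<^sub>R \<phi>' x"])
    fix y assume y: "y \<in> {0..r}"
    show "((\<lambda>y. \<phi> (x + y) - \<phi> (x - y) - (2 * y) *\<^sub>R \<phi>' x) has_vector_derivative
        \<phi>' (x + y) + \<phi>' (x - y) - 2 *\<^sub>R \<phi>' x) (at y)"
      by (rule has_vector_derivative_eq_rhs,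
          (rule has_vector_derivative_diff has_vector_derivative_scaleR derivative_intros
                has_vector_derivative_shift_plus[OF d1] has_vector_derivative_shift_minus[OF d1])+) simp
    have "norm (\<phi>' (x + y) + \<phi>' (x - y) - 2 *\<^sub>R \<phi>' x) \<le> 2 * B * y^2"
      using second_difference_bound[OF d2 d3 B] y by simp
    also have "\<dots> \<le> 2 * B * r^2" using y B0 by (intro mult_left_mono power_mono) auto
    finally show "norm (\<phi>' (x + y) + \<phi>' (x - y) - 2 *\<^sub>R \<phi>' x) \<le> 2 * B * r^2" .
  qed (use r in auto)
  then show ?thesis by (simp add: power2_eq_square power3_eq_cube mult.assoc)
qed

text \<open>Trapezoidal rule: the second difference of \<phi> equals (r/2)(\<phi>'(x+r) - \<phi>'(x-r)) up to B r^3.\<close>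

lemma trapezoid_difference_bound:
  fixes \<phi> \<phi>' \<phi>'' \<phi>''' :: "real \<Rightarrow> 'a::real_normed_vector"
  assumes d1: "\<And>z. (\<phi> has_vector_derivative \<phi>' z) (at z)"
    and d2: "\<And>z. (\<phi>' has_vector_derivative \<phi>'' z) (at z)"
    and d3: "\<And>z. (\<phi>'' has_vector_derivative \<phi>''' z) (at z)"
    and B: "\<And>z. norm (\<phi>''' z) \<le> B" and r: "0 \<le> r"
  shows "norm (\<phi> (x + r) - 2 *\<^sub>R \<phi> x + \<phi> (x - r) - (r / 2) *\<^sub>R (\<phi>' (x + r) - \<phi>' (x - r))) \<le> B * r^3"
proof -
  have dh: "\<And>y. ((\<lambda>y. y/2) has_field_derivative 1/2) (at y)"
    by (auto intro!: derivative_eq_intros)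
  have halves: "\<And>v::'a. (1/2) *\<^sub>R v + (1/2) *\<^sub>R v = v"
    by (simp flip: scaleR_add_left)
  have "norm ((\<lambda>y. \<phi> (x + y) - 2 *\<^sub>R \<phi> x + \<phi> (x - y) - (y / 2) *\<^sub>R (\<phi>' (x + y) - \<phi>' (x - y))) r
      - (\<lambda>y. \<phi> (x + y) - 2 *\<^sub>R \<phi> x + \<phi> (x - y) - (y / 2) *\<^sub>R (\<phi>' (x + y) - \<phi>' (x - y))) 0
      - (r - 0) *\<^sub>R ((1/2) *\<^sub>R (\<phi>' (x + 0) - \<phi>' (x - 0)) - (0 / 2) *\<^sub>R (\<phi>'' (x + 0) + \<phi>'' (x - 0))))
      \<le> (B * r) * (r - 0)^2"
  proof (rule taylor2_bound[where \<phi>'="\<lambda>y. (1/2) *\<^sub>R (\<phi>' (x + y) - \<phi>' (x - y)) - (y / 2) *\<^sub>R (\<phi>'' (x + y) + \<phi>'' (x - y))"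
        and \<phi>''="\<lambda>y. - (y / 2) *\<^sub>R (\<phi>''' (x + y) - \<phi>''' (x - y))"])
    fix y
    show "((\<lambda>y. \<phi> (x + y) - 2 *\<^sub>R \<phi> x + \<phi> (x - y) - (y / 2) *\<^sub>R (\<phi>' (x + y) - \<phi>' (x - y)))
        has_vector_derivative (1/2) *\<^sub>R (\<phi>' (x + y) - \<phi>' (x - y)) - (y / 2) *\<^sub>R (\<phi>'' (x + y) + \<phi>'' (x - y))) (at y)"
      by (rule has_vector_derivative_eq_rhs,
          (rule has_vector_derivative_diff has_vector_derivative_add has_vector_derivative_scaleR
                dh derivative_intros has_vector_derivative_shift_plus[OF d1] has_vector_derivative_shift_minus[OF d1]
                has_vector_derivative_shift_plus[OF d2] has_vector_derivative_shift_minus[OF d2])+)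
         (simp add: algebra_simps halves)
    show "((\<lambda>y. (1/2) *\<^sub>R (\<phi>' (x + y) - \<phi>' (x - y)) - (y / 2) *\<^sub>R (\<phi>'' (x + y) + \<phi>'' (x - y)))
        has_vector_derivative - (y / 2) *\<^sub>R (\<phi>''' (x + y) - \<phi>''' (x - y))) (at y)"
      by (rule has_vector_derivative_eq_rhs,
          (rule has_vector_derivative_diff has_vector_derivative_add has_vector_derivative_scaleR
                dh derivative_intros has_vector_derivative_shift_plus[OF d2] has_vector_derivative_shift_minus[OF d2]
                has_vector_derivative_shift_plus[OF d3] has_vector_derivative_shift_minus[OF d3])+)
         (simp add: algebra_simps)
  next
    fix y assume y: "y \<in> {0..r}"
    have "norm (\<phi>''' (x + y) - \<phi>''' (x - y)) \<le> 2 * B"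
      using norm_triangle_ineq4[of "\<phi>''' (x + y)" "\<phi>''' (x - y)"] B[of "x + y"] B[of "x - y"] by simp
    then have "\<bar>y/2\<bar> * norm (\<phi>''' (x + y) - \<phi>''' (x - y)) \<le> (r/2) * (2 * B)"
      using y by (intro mult_mono) auto
    then show "norm (- (y / 2) *\<^sub>R (\<phi>''' (x + y) - \<phi>''' (x - y))) \<le> B * r" by (simp add: mult.commute)
  qed (use r in auto)
  then show ?thesis by (simp add: power2_eq_square power3_eq_cube mult.assoc scaleR_2 algebra_simps)
qed

text \<open>For a smooth function the iterated partial derivatives are genuine derivatives.\<close>

lemma smooth_tx_has_derivative_x:
  assumes "smooth_tx g" "0 < t"
  shows "((\<lambda>y. pDw w g t y) has_vector_derivative pDw (False # w) g t y) (at y)"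
proof -
  have "(\<lambda>y. pDw w g t y) differentiable (at y)" using assms unfolding smooth_tx_def by blast
  then show ?thesis by (simp add: vector_derivative_works pdx_def)
qed

lemma smooth_tx_has_derivative_t:
  assumes "smooth_tx g" "0 < t"
  shows "((\<lambda>s. pDw w g s y) has_vector_derivative pDw (True # w) g t y) (at t)"
proof -
  have "(\<lambda>s. pDw w g s y) differentiable (at t)" using assms unfolding smooth_tx_def by blast
  then show ?thesis by (simp add: vector_derivative_works pdt_def)
qed

lemma pD_eq_pDw: "pD p q g = pDw (replicate p True @ replicate q False) g"
proof -
  have "(pdx ^^ q) g = pDw (replicate q False) g" for g :: "real \<Rightarrow> real \<Rightarrow> 'a"
    by (induction q) auto
  then show ?thesis unfolding pD_def by (induction p) auto
qed

text \<open>Partial derivatives commute with fixed linear combinations of smooth functions.\<close>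

lemma pDw_linear_combination:
  fixes g :: "'b \<Rightarrow> real \<Rightarrow> real \<Rightarrow> real^'n" and A :: "'b \<Rightarrow> real^'n^'m"
  assumes S: "finite S"
    and sm: "\<And>b. b \<in> S \<Longrightarrow> smooth_tx (g b)"
  shows "0 < t \<Longrightarrow> pDw w (\<lambda>s y. \<Sum>b\<in>S. A b *v g b s y) t x = (\<Sum>b\<in>S. A b *v pDw w (g b) t x)"
proof (induction w arbitrary: t x)
  case Nil
  then show ?case by simp
next
  case (Cons c w)
  have lin: "((\<lambda>z. \<Sum>b\<in>S. A b *v k b z) has_vector_derivative (\<Sum>b\<in>S. A b *v k' b)) (at z0)"
    if "\<And>b. b \<in> S \<Longrightarrow> (k b has_vector_derivative k' b) (at z0)" for k k' z0
    by (rule has_vector_derivative_sum, rule bounded_linear.has_vector_derivative[OF matrix_vector_mul_bounded_linear],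
        rule that)
  show ?case
  proof (cases c)
    case True
    have "pdt (pDw w (\<lambda>s y. \<Sum>b\<in>S. A b *v g b s y)) t x
        = vector_derivative (\<lambda>s. \<Sum>b\<in>S. A b *v pDw w (g b) s x) (at t)"
      unfolding pdt_def
    proof (rule vector_derivative_cong_eq)
      show "\<forall>\<^sub>F s in nhds t. s \<in> UNIV \<longrightarrow> pDw w (\<lambda>s y. \<Sum>b\<in>S. A b *v g b s y) s x
              = (\<Sum>b\<in>S. A b *v pDw w (g b) s x)"
        using eventually_nhds_in_open[of "{0<..}" t] Cons.prems
        by (auto elim!: eventually_mono intro: Cons.IH)
    qed auto
    also have "\<dots> = (\<Sum>b\<in>S. A b *v pDw (True # w) (g b) t x)"
      by (rule vector_derivative_at, rule lin, rule smooth_tx_has_derivative_t[OF sm Cons.prems])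
    finally show ?thesis using True by simp
  next
    case False
    have "pDw w (\<lambda>s y. \<Sum>b\<in>S. A b *v g b s y) t = (\<lambda>y. \<Sum>b\<in>S. A b *v pDw w (g b) t y)"
      by (rule ext, rule Cons.IH[OF Cons.prems])
    then have "pdx (pDw w (\<lambda>s y. \<Sum>b\<in>S. A b *v g b s y)) t x
        = vector_derivative (\<lambda>y. \<Sum>b\<in>S. A b *v pDw w (g b) t y) (at x)"
      unfolding pdx_def by simp
    also have "\<dots> = (\<Sum>b\<in>S. A b *v pDw (False # w) (g b) t x)"
      by (rule vector_derivative_at, rule lin, rule smooth_tx_has_derivative_x[OF sm Cons.prems])
    finally show ?thesis using False by simp
  qed
qed

text \<open>Mixed difference: a bound on g_tx for later times bounds the spatial variation of g_t.
  Only one-sided time differences are used, so no symmetry of mixed derivatives is needed.\<close>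

lemma mixed_difference_bound:
  assumes sm: "smooth_tx g" and t: "0 < t"
    and C: "\<And>s y. t \<le> s \<Longrightarrow> norm (pdt (pdx g) s y) \<le> C"
  shows "norm (pdt g t b - pdt g t a) \<le> C * \<bar>b - a\<bar>"
proof (rule derivative_bound_from_differences[where \<psi>="\<lambda>s. g s b - g s a"])
  show "((\<lambda>s. g s b - g s a) has_vector_derivative pdt g t b - pdt g t a) (at t)"
    using smooth_tx_has_derivative_t[OF sm t, of "[]" b] smooth_tx_has_derivative_t[OF sm t, of "[]" a]
    by (auto intro: has_vector_derivative_diff)
  fix h :: real assume h: "0 < h" "h < 1"
  have "norm ((g (t+h) b - g t b) - (g (t+h) a - g t a)) \<le> (C * h) * \<bar>b - a\<bar>"
  proof (rule mean_value_bound_abs[where \<phi>'="\<lambda>y. pdx g (t+h) y - pdx g t y"])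
    fix y
    show "((\<lambda>y. g (t + h) y - g t y) has_vector_derivative pdx g (t + h) y - pdx g t y) (at y)"
      using smooth_tx_has_derivative_x[OF sm, of "t+h" "[]" y] smooth_tx_has_derivative_x[OF sm t, of "[]" y] h t
      by (auto intro: has_vector_derivative_diff)
    have "norm (pdx g (t + h) y - pdx g t y) \<le> C * (t + h - t)"
    proof (rule mean_value_bound[where \<phi>="\<lambda>s. pdx g s y" and \<phi>'="\<lambda>s. pdt (pdx g) s y"])
      fix s assume s: "s \<in> {t..t+h}"
      show "((\<lambda>s. pdx g s y) has_vector_derivative pdt (pdx g) s y) (at s)"
        using smooth_tx_has_derivative_t[OF sm, of s "[False]" y] s t by auto
      show "norm (pdt (pdx g) s y) \<le> C" using C s by auto
    qed (use h in auto)
    then show "norm (pdx g (t + h) y - pdx g t y) \<le> C * h" by simp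
  qed
  then show "norm ((g (t + h) b - g (t + h) a) - (g t b - g t a)) \<le> C * \<bar>b - a\<bar> * h"
    by (simp add: algebra_simps)
qed

text \<open>Exact algebraic decomposition of the ROE residual of one component.  Here gm, g0, gp are
  the values at x - r, x, x + r, gn the value at the next time level, G1 and Gt the x- and
  t-derivatives, and Q = Gt + lam G1 + g is the right-hand side of the BGK equation (so the
  source terms cancel against the differential equation).  What remains are Taylor
  remainders in time, central and second differences, and spatial variations of g_t.\<close>

lemma roe_residual_decomposition:
  fixes gn gm g0 gp G1m G1z G1p Gtm Gtz Gtp Qm Qz Qp :: "real^'n"
  assumes dt: "dt \<noteq> 0" and r: "r \<noteq> 0"
    and Qm: "Qm = Gtm + lam *\<^sub>R G1m + gm"
    and Qz: "Qz = Gtz + lam *\<^sub>R G1z + g0"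
    and Qp: "Qp = Gtp + lam *\<^sub>R G1p + gp"
  shows "(1 / dt) *\<^sub>R (gn - g0) + (lam / (2 * r)) *\<^sub>R (gp - gm)
        - (\<bar>lam\<bar> / (2 * r)) *\<^sub>R (gp - 2 *\<^sub>R g0 + gm)
        - ( (1/4) *\<^sub>R (Qm + 2 *\<^sub>R Qz + Qp) + (sgn lam / 4) *\<^sub>R (Qm - Qp)
          - (1/4) *\<^sub>R (gm + 2 *\<^sub>R g0 + gp) - (sgn lam / 4) *\<^sub>R (gm - gp))
      = (1 / dt) *\<^sub>R (gn - g0 - dt *\<^sub>R Gtz)
        + (lam / (2 * r)) *\<^sub>R (gp - gm - (2 * r) *\<^sub>R G1z)
        - (\<bar>lam\<bar> / (2 * r)) *\<^sub>R (gp - 2 *\<^sub>R g0 + gm - (r / 2) *\<^sub>R (G1p - G1m))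
        - (lam / 4) *\<^sub>R (G1p + G1m - 2 *\<^sub>R G1z)
        - ((1 + sgn lam) / 4) *\<^sub>R (Gtm - Gtz) - ((1 - sgn lam) / 4) *\<^sub>R (Gtp - Gtz)"
proof -
  have abs_lam: "sgn lam * lam = \<bar>lam\<bar>" by (simp add: sgn_real_def)
  show ?thesis
    unfolding Qm Qz Qp using dt r by (simp add: vec_eq_iff field_simps flip: abs_lam)
qed

text \<open>Bounding the decomposition term by term, given the size of each remainder.\<close>

lemma roe_remainder_bound:
  fixes D0 D1 D2 D3 D4m D4p :: "'a::real_normed_vector"
  assumes dt: "0 < dt" and r: "0 < r"
    and n0: "norm D0 \<le> B * dt^2" and n1: "norm D1 \<le> 2 * B * r^3" and n2: "norm D2 \<le> B * r^3"
    and n3: "norm D3 \<le> 2 * B * r^2" and n4m: "norm D4m \<le> B * r" and n4p: "norm D4p \<le> B * r"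
  shows "norm ((1 / dt) *\<^sub>R D0 + (lam / (2 * r)) *\<^sub>R D1 - (\<bar>lam\<bar> / (2 * r)) *\<^sub>R D2 - (lam / 4) *\<^sub>R D3
        - ((1 + sgn lam) / 4) *\<^sub>R D4m - ((1 - sgn lam) / 4) *\<^sub>R D4p) \<le> B * (dt + r + 2 * \<bar>lam\<bar> * r^2)"
proof -
  have B0: "0 \<le> B" using n4m r by (meson norm_ge_zero order.trans zero_le_mult_iff not_le)
  have sg: "0 \<le> 1 + sgn lam" "0 \<le> 1 - sgn lam" by (simp_all add: sgn_real_def)
  have w0: "norm ((1 / dt) *\<^sub>R D0) \<le> B * dt"
    using n0 dt by (simp add: divide_le_eq power2_eq_square mult.commute mult.left_commute)
  have w1: "norm ((lam / (2 * r)) *\<^sub>R D1) \<le> \<bar>lam\<bar> * B * r^2"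
  proof -
    have "norm ((lam / (2 * r)) *\<^sub>R D1) = (\<bar>lam\<bar> / (2 * r)) * norm D1" using r by simp
    also have "\<dots> \<le> (\<bar>lam\<bar> / (2 * r)) * (2 * B * r^3)" using n1 r by (intro mult_left_mono) auto
    also have "\<dots> = \<bar>lam\<bar> * B * r^2" using r by (simp add: power2_eq_square power3_eq_cube field_simps)
    finally show ?thesis .
  qed
  have w2: "norm ((\<bar>lam\<bar> / (2 * r)) *\<^sub>R D2) \<le> \<bar>lam\<bar> * B * r^2 / 2"
  proof -
    have "norm ((\<bar>lam\<bar> / (2 * r)) *\<^sub>R D2) = (\<bar>lam\<bar> / (2 * r)) * norm D2" using r by simp
    also have "\<dots> \<le> (\<bar>lam\<bar> / (2 * r)) * (B * r^3)" using n2 r by (intro mult_left_mono) auto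
    also have "\<dots> = \<bar>lam\<bar> * B * r^2 / 2" using r by (simp add: power2_eq_square power3_eq_cube field_simps)
    finally show ?thesis .
  qed
  have w3: "norm ((lam / 4) *\<^sub>R D3) \<le> \<bar>lam\<bar> * B * r^2 / 2"
    using mult_left_mono[OF n3, of "\<bar>lam\<bar> / 4"] by (simp add: mult_ac)
  have w4m: "norm (((1 + sgn lam) / 4) *\<^sub>R D4m) \<le> ((1 + sgn lam) / 4) * (B * r)"
    using mult_left_mono[OF n4m, of "(1 + sgn lam) / 4"] sg by simp
  have w4p: "norm (((1 - sgn lam) / 4) *\<^sub>R D4p) \<le> ((1 - sgn lam) / 4) * (B * r)"
    using mult_left_mono[OF n4p, of "(1 - sgn lam) / 4"] sg by simp
  have "norm ((1 / dt) *\<^sub>R D0 + (lam / (2 * r)) *\<^sub>R D1 - (\<bar>lam\<bar> / (2 * r)) *\<^sub>R D2 - (lam / 4) *\<^sub>R D3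
        - ((1 + sgn lam) / 4) *\<^sub>R D4m - ((1 - sgn lam) / 4) *\<^sub>R D4p)
      \<le> norm ((1 / dt) *\<^sub>R D0) + norm ((lam / (2 * r)) *\<^sub>R D1) + norm ((\<bar>lam\<bar> / (2 * r)) *\<^sub>R D2)
        + norm ((lam / 4) *\<^sub>R D3) + norm (((1 + sgn lam) / 4) *\<^sub>R D4m) + norm (((1 - sgn lam) / 4) *\<^sub>R D4p)"
    by (smt (verit) norm_triangle_ineq norm_triangle_ineq4)
  also have "\<dots> \<le> B * dt + 2 * \<bar>lam\<bar> * B * r^2 + B * r / 2"
  proof -
    have "((1 + sgn lam) / 4) * (B * r) + ((1 - sgn lam) / 4) * (B * r) = B * r / 2"
      by (simp add: field_simps)
    then show ?thesis using w0 w1 w2 w3 w4m w4p by linarith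
  qed
  also have "\<dots> \<le> B * (dt + r + 2 * \<bar>lam\<bar> * r^2)"
    using B0 r by (simp add: algebra_simps)
  finally show ?thesis .
qed

text \<open>Consistency of the ROE scheme for one component: if f^i solves its BGK equation and
  f^i_tt, f^i_tx (for times \<ge> t) and f^i_xxx (at time t) are bounded by B, the local
  truncation error at (t, x) is at most B (dt + r + 2 |lam_i| r^2), r the space step.\<close>

lemma roe_trunc_bound:
  fixes f :: "nat \<Rightarrow> real \<Rightarrow> real \<Rightarrow> real^'k"
  assumes sm: "smooth_tx (f i)" and t: "0 < t" and r: "0 < r" and dt: "0 < dt"
    and bgk: "\<And>y. pdt (f i) t y + lam i *\<^sub>R pdx (f i) t y = M i (\<Sum>l<m. f l t y) - f i t y"
    and Btt: "\<And>s y. t \<le> s \<Longrightarrow> norm (pdt (pdt (f i)) s y) \<le> B"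
    and Btx: "\<And>s y. t \<le> s \<Longrightarrow> norm (pdt (pdx (f i)) s y) \<le> B"
    and Bxxx: "\<And>y. norm (pdx (pdx (pdx (f i))) t y) \<le> B"
  shows "norm (roe_trunc lam M m f r dt i t x) \<le> B * (dt + r + 2 * \<bar>lam i\<bar> * r^2)"
proof -
  define g where "g = f i"
  define G1 where "G1 = pdx g t"
  define G2 where "G2 = pdx (pdx g) t"
  define G3 where "G3 = pdx (pdx (pdx g)) t"
  define Gt where "Gt = pdt g t"
  have smg: "smooth_tx g" using sm by (simp add: g_def)
  have d0: "\<And>z. ((\<lambda>y. g t y) has_vector_derivative G1 z) (at z)"
    using smooth_tx_has_derivative_x[OF smg t, of "[]"] by (simp add: G1_def)
  have d1: "\<And>z. (G1 has_vector_derivative G2 z) (at z)"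
    using smooth_tx_has_derivative_x[OF smg t, of "[False]"] by (simp add: G1_def G2_def)
  have d2: "\<And>z. (G2 has_vector_derivative G3 z) (at z)"
    using smooth_tx_has_derivative_x[OF smg t, of "[False,False]"] by (simp add: G2_def G3_def)
  have b3: "\<And>z. norm (G3 z) \<le> B" using Bxxx by (simp add: G3_def g_def)
  have time_taylor: "norm (g (t + dt) x - g t x - dt *\<^sub>R Gt x) \<le> B * dt^2"
  proof -
    have "norm ((\<lambda>s. g s x) (t + dt) - (\<lambda>s. g s x) t - (t + dt - t) *\<^sub>R pdt g t x) \<le> B * (t + dt - t)^2"
    proof (rule taylor2_bound[where \<phi>'="\<lambda>s. pdt g s x" and \<phi>''="\<lambda>s. pdt (pdt g) s x"])
      fix s assume s: "s \<in> {t..t+dt}"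
      then have s0: "0 < s" using t by auto
      show "((\<lambda>s. g s x) has_vector_derivative pdt g s x) (at s)"
        using smooth_tx_has_derivative_t[OF smg s0, of "[]" x] by simp
      show "((\<lambda>s. pdt g s x) has_vector_derivative pdt (pdt g) s x) (at s)"
        using smooth_tx_has_derivative_t[OF smg s0, of "[True]" x] by simp
      show "norm (pdt (pdt g) s x) \<le> B" using Btt s by (auto simp: g_def)
    qed (use dt in auto)
    then show ?thesis by (simp add: Gt_def)
  qed
  have central: "norm (g t (x + r) - g t (x - r) - (2 * r) *\<^sub>R G1 x) \<le> 2 * B * r^3"
    using central_difference_bound[OF d0 d1 d2 b3, of r x] r by simp
  have trapezoid: "norm (g t (x + r) - 2 *\<^sub>R g t x + g t (x - r) - (r / 2) *\<^sub>R (G1 (x + r) - G1 (x - r)))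
      \<le> B * r^3"
    using trapezoid_difference_bound[OF d0 d1 d2 b3, of r x] r by simp
  have second: "norm (G1 (x + r) + G1 (x - r) - 2 *\<^sub>R G1 x) \<le> 2 * B * r^2"
    using second_difference_bound[OF d1 d2 b3, of r x] r by simp
  have mixed_p: "norm (Gt (x + r) - Gt x) \<le> B * r"
    using mixed_difference_bound[OF smg t, of B "x + r" x] Btx r by (simp add: Gt_def g_def)
  have mixed_m: "norm (Gt (x - r) - Gt x) \<le> B * r"
    using mixed_difference_bound[OF smg t, of B "x - r" x] Btx r by (simp add: Gt_def g_def)
  have source: "M i (\<Sum>l<m. f l t y) = Gt y + lam i *\<^sub>R G1 y + g t y" for y
    using bgk[of y] by (simp add: Gt_def G1_def g_def algebra_simps)
  have "norm (roe_trunc lam M m f r dt i t x)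
      = norm ((1 / dt) *\<^sub>R (g (t + dt) x - g t x - dt *\<^sub>R Gt x)
        + (lam i / (2 * r)) *\<^sub>R (g t (x + r) - g t (x - r) - (2 * r) *\<^sub>R G1 x)
        - (\<bar>lam i\<bar> / (2 * r)) *\<^sub>R (g t (x + r) - 2 *\<^sub>R g t x + g t (x - r) - (r / 2) *\<^sub>R (G1 (x + r) - G1 (x - r)))
        - (lam i / 4) *\<^sub>R (G1 (x + r) + G1 (x - r) - 2 *\<^sub>R G1 x)
        - ((1 + sgn (lam i)) / 4) *\<^sub>R (Gt (x - r) - Gt x) - ((1 - sgn (lam i)) / 4) *\<^sub>R (Gt (x + r) - Gt x))"
    unfolding roe_trunc_def Let_def source g_def[symmetric]
    by (subst roe_residual_decomposition) (use r dt in simp_all)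
  also have "\<dots> \<le> B * (dt + r + 2 * \<bar>lam i\<bar> * r^2)"
    by (rule roe_remainder_bound[OF dt r time_taylor central trapezoid second mixed_m mixed_p])
  finally show ?thesis .
qed

text \<open>Norm of a sum of matrix-vector products, via operator norms.\<close>

lemma norm_matrix_vector_sum_le:
  fixes A :: "'b \<Rightarrow> real^'n^'m" and v :: "'b \<Rightarrow> real^'n"
  assumes "\<And>b. b \<in> S \<Longrightarrow> norm (v b) \<le> c b"
  shows "norm (\<Sum>b\<in>S. A b *v v b) \<le> (\<Sum>b\<in>S. onorm ((*v) (A b)) * c b)"
proof -
  have "norm (\<Sum>b\<in>S. A b *v v b) \<le> (\<Sum>b\<in>S. norm (A b *v v b))" by (rule norm_sum)
  also have "\<dots> \<le> (\<Sum>b\<in>S. onorm ((*v) (A b)) * c b)"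
  proof (rule sum_mono)
    fix b assume b: "b \<in> S"
    have "norm (A b *v v b) \<le> onorm ((*v) (A b)) * norm (v b)"
      by (rule onorm[OF matrix_vector_mul_bounded_linear])
    also have "\<dots> \<le> onorm ((*v) (A b)) * c b"
      using assms[OF b] onorm_pos_le[OF matrix_vector_mul_bounded_linear] by (rule mult_left_mono)
    finally show "norm (A b *v v b) \<le> onorm ((*v) (A b)) * c b" .
  qed
  finally show ?thesis .
qed

text \<open>If D^T D = diag(h_1,...,h_m) with invertible h_i, then v_i is recovered from Z = D v as
  v_i = \<Sum>_a h_i^{-1} D_{ai}^T Z_a.  This is how information on Z passes to the f^i.\<close>

lemma block_left_inverse:
  fixes D :: "nat \<Rightarrow> nat \<Rightarrow> real^'k^'k" and h :: "nat \<Rightarrow> real^'k^'k" and v :: "nat \<Rightarrow> real^'k"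
  assumes DtD: "\<forall>b<m. \<forall>c<m. (\<Sum>a<m. transpose (D a b) ** D a c) = (if b = c then h b else 0)"
    and h_inv: "invertible (h i)" and i: "i < m"
  shows "(\<Sum>a<m. (matrix_inv (h i) ** transpose (D a i)) *v (\<Sum>b<m. D a b *v v b)) = v i"
proof -
  have mv_sum: "(A::real^'k^'k) *v (\<Sum>b\<in>S. w b) = (\<Sum>b\<in>S. A *v w b)" for A S w
    by (induction S rule: infinite_finite_induct) (auto simp: matrix_vector_right_distrib)
  have sum_mv: "(\<Sum>a\<in>S. (B a::real^'k^'k)) *v w = (\<Sum>a\<in>S. B a *v w)" for B S w
    by (induction S rule: infinite_finite_induct) (auto simp: matrix_vector_mult_add_rdistrib)
  have mm_sum: "(A::real^'k^'k) ** (\<Sum>a\<in>S. B a) = (\<Sum>a\<in>S. A ** (B a::real^'k^'k))" for A S B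
    by (induction S rule: infinite_finite_induct) (auto simp: matrix_add_ldistrib)
  have inv_left: "matrix_inv (h i) ** h i = mat 1"
    using h_inv unfolding invertible_def matrix_inv_def by (rule someI2_ex) auto
  have "(\<Sum>a<m. (matrix_inv (h i) ** transpose (D a i)) *v (\<Sum>b<m. D a b *v v b))
      = (\<Sum>b<m. \<Sum>a<m. (matrix_inv (h i) ** transpose (D a i) ** D a b) *v v b)"
    by (simp add: mv_sum matrix_vector_mul_assoc) (rule sum.swap)
  also have "\<dots> = (\<Sum>b<m. (matrix_inv (h i) ** (\<Sum>a<m. transpose (D a i) ** D a b)) *v v b)"
    by (simp add: sum_mv[symmetric] mm_sum matrix_mul_assoc)
  also have "\<dots> = (\<Sum>b<m. if b = i then v b else 0)"
    using DtD i inv_left by (intro sum.cong) auto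
  also have "\<dots> = v i" using i by simp
  finally show ?thesis .
qed

text \<open>Decay of order t^\<gamma> (uniformly in x, for t \<ge> 1) of the mixed derivative d_t^p d_x^q g.\<close>

definition decays :: "nat \<Rightarrow> nat \<Rightarrow> real \<Rightarrow> (real \<Rightarrow> real \<Rightarrow> 'a::real_normed_vector) \<Rightarrow> bool" where
  "decays p q \<gamma> g \<longleftrightarrow> (\<exists>C. \<forall>t\<ge>1. \<forall>x. norm (pD p q g t x) \<le> C * t powr \<gamma>)"

text \<open>Finitely many decaying functions admit a common nonnegative constant.\<close>

lemma decays_uniform:
  assumes S: "finite S" and dec: "\<forall>a\<in>S. decays p q \<gamma> (g a)"
  shows "\<exists>C\<ge>0. \<forall>a\<in>S. \<forall>t\<ge>1. \<forall>x. norm (pD p q (g a) t x) \<le> C * t powr \<gamma>"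
proof -
  obtain C where C: "\<And>a t x. a \<in> S \<Longrightarrow> 1 \<le> t \<Longrightarrow> norm (pD p q (g a) t x) \<le> C a * t powr \<gamma>"
    using dec unfolding decays_def by metis
  have "norm (pD p q (g a) t x) \<le> (\<Sum>b\<in>S. \<bar>C b\<bar>) * t powr \<gamma>" if a: "a \<in> S" and t: "1 \<le> t" for a t x
  proof -
    have "C a \<le> (\<Sum>b\<in>S. \<bar>C b\<bar>)"
      using member_le_sum[of a S "\<lambda>b. \<bar>C b\<bar>"] S a by simp
    then show ?thesis using C[OF a t, of x] by (meson mult_right_mono order.trans powr_ge_zero)
  qed
  then show ?thesis by (intro exI[of _ "\<Sum>b\<in>S. \<bar>C b\<bar>"]) (auto intro: sum_nonneg)
qed

text \<open>Decay is inherited by fixed linear combinations of derivatives.\<close>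

lemma decays_linear_combination:
  fixes G :: "'b \<Rightarrow> real \<Rightarrow> real \<Rightarrow> real^'n" and A :: "'b \<Rightarrow> real^'n^'m"
    and g :: "real \<Rightarrow> real \<Rightarrow> real^'m"
  assumes S: "finite S" and dec: "\<forall>a\<in>S. decays p q \<gamma> (G a)"
    and comb: "\<And>t x. 1 \<le> t \<Longrightarrow> pD p q g t x = (\<Sum>a\<in>S. A a *v pD p q (G a) t x)"
  shows "decays p q \<gamma> g"
proof -
  obtain C where C: "\<And>a t x. a \<in> S \<Longrightarrow> 1 \<le> t \<Longrightarrow> norm (pD p q (G a) t x) \<le> C * t powr \<gamma>"
    using decays_uniform[OF S dec] by blast
  have "norm (pD p q g t x) \<le> (\<Sum>a\<in>S. onorm ((*v) (A a)) * C) * t powr \<gamma>" if t: "1 \<le> t" for t x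
    using norm_matrix_vector_sum_le[of S "\<lambda>a. pD p q (G a) t x" "\<lambda>_. C * t powr \<gamma>" A] C t
    by (simp add: comb[OF t] sum_distrib_right mult.assoc)
  then show ?thesis unfolding decays_def by blast
qed

text \<open>Decay of all components of Z = D f implies decay of every f^i.\<close>

lemma components_decay:
  fixes f :: "nat \<Rightarrow> real \<Rightarrow> real \<Rightarrow> real^'k" and D :: "nat \<Rightarrow> nat \<Rightarrow> real^'k^'k"
  assumes DtD: "\<forall>b<m. \<forall>c<m. (\<Sum>a<m. transpose (D a b) ** D a c) = (if b = c then h b else 0)"
    and h_inv: "\<forall>b<m. invertible (h b)"
    and smooth: "\<forall>i<m. smooth_tx (f i)"
    and decZ: "\<forall>a<m. decays p q \<gamma> (\<lambda>s y. \<Sum>b<m. D a b *v f b s y)"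
    and i: "i < m"
  shows "decays p q \<gamma> (f i)"
proof (rule decays_linear_combination[where A="\<lambda>a. matrix_inv (h i) ** transpose (D a i)"])
  show "finite {..<m}" "\<forall>a\<in>{..<m}. decays p q \<gamma> (\<lambda>s y. \<Sum>b<m. D a b *v f b s y)"
    using decZ by auto
  fix t x :: real assume "1 \<le> t"
  then have "pD p q (\<lambda>s y. \<Sum>b<m. D a b *v f b s y) t x = (\<Sum>b<m. D a b *v pD p q (f b) t x)" for a
    unfolding pD_eq_pDw using smooth by (intro pDw_linear_combination) auto
  then show "pD p q (f i) t x = (\<Sum>a<m. (matrix_inv (h i) ** transpose (D a i))
      *v pD p q (\<lambda>s y. \<Sum>b<m. D a b *v f b s y) t x)"
    using block_left_inverse[OF DtD _ i] h_inv i by simp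
qed

text \<open>With dt = \<rho> dx, t^{-2} decay of f^i_tt, f^i_tx and f^i_xxx makes every component of the
  truncation error O(dx t^{-2}) for t \<ge> 1, uniformly in x and in dx \<le> 1.\<close>

lemma roe_truncation_decay:
  fixes f :: "nat \<Rightarrow> real \<Rightarrow> real \<Rightarrow> real^'k"
  assumes smooth: "\<forall>i<m. smooth_tx (f i)"
    and bgk: "\<forall>i<m. \<forall>t>0. \<forall>x. pdt (f i) t x + lam i *\<^sub>R pdx (f i) t x = M i (\<Sum>l<m. f l t x) - f i t x"
    and dec: "\<forall>i<m. decays 2 0 (-2) (f i) \<and> decays 1 1 (-2) (f i) \<and> decays 0 3 (-2) (f i)"
    and rho: "0 < \<rho>"
  shows "\<exists>C\<ge>0. \<forall>i<m. \<forall>dx t x. 0 < dx \<longrightarrow> dx \<le> 1 \<longrightarrow> 1 \<le> t \<longrightarrow>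
           norm (roe_trunc lam M m f dx (\<rho> * dx) i t x) \<le> C * (dx * t powr (-2))"
proof -
  have pD_unfold: "pD 2 0 g = pdt (pdt g)" "pD 1 1 g = pdt (pdx g)" "pD 0 3 g = pdx (pdx (pdx g))"
    for g :: "real \<Rightarrow> real \<Rightarrow> real^'k"
    by (simp_all add: pD_def numeral_eq_Suc)
  obtain B1 B2 B3 where B: "0 \<le> B1" "0 \<le> B2" "0 \<le> B3"
    and tt: "\<And>i s y. i < m \<Longrightarrow> 1 \<le> s \<Longrightarrow> norm (pdt (pdt (f i)) s y) \<le> B1 * s powr (-2)"
    and tx: "\<And>i s y. i < m \<Longrightarrow> 1 \<le> s \<Longrightarrow> norm (pdt (pdx (f i)) s y) \<le> B2 * s powr (-2)"
    and xxx: "\<And>i s y. i < m \<Longrightarrow> 1 \<le> s \<Longrightarrow> norm (pdx (pdx (pdx (f i))) s y) \<le> B3 * s powr (-2)"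
    using decays_uniform[of "{..<m}" 2 0 "-2" f] decays_uniform[of "{..<m}" 1 1 "-2" f]
      decays_uniform[of "{..<m}" 0 3 "-2" f] dec unfolding pD_unfold by auto
  define B where "B = B1 + B2 + B3"
  have later: "norm (pdt (pdt (f i)) s y) \<le> B * t powr (-2)" "norm (pdt (pdx (f i)) s y) \<le> B * t powr (-2)"
    "norm (pdx (pdx (pdx (f i))) s y) \<le> B * t powr (-2)"
    if "i < m" "1 \<le> t" "t \<le> s" for i t s y
  proof -
    have "s powr (-2) \<le> t powr (-2)" using that by (intro powr_mono2') auto
    then have "B1 * s powr (-2) \<le> B * t powr (-2)" "B2 * s powr (-2) \<le> B * t powr (-2)"
      "B3 * s powr (-2) \<le> B * t powr (-2)"
      using B unfolding B_def by (intro mult_mono; simp)+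
    then show "norm (pdt (pdt (f i)) s y) \<le> B * t powr (-2)" "norm (pdt (pdx (f i)) s y) \<le> B * t powr (-2)"
      "norm (pdx (pdx (pdx (f i))) s y) \<le> B * t powr (-2)"
      using tt[of i s y] tx[of i s y] xxx[of i s y] that by linarith+
  qed
  define L where "L = (\<Sum>i<m. \<bar>lam i\<bar>)"
  have C0: "0 \<le> B * (\<rho> + 1 + 2 * L)" using B rho by (simp add: B_def L_def sum_nonneg)
  have "norm (roe_trunc lam M m f dx (\<rho> * dx) i t x) \<le> B * (\<rho> + 1 + 2 * L) * (dx * t powr (-2))"
    if i: "i < m" and dx: "0 < dx" "dx \<le> 1" and t: "1 \<le> t" for i dx t x
  proof -
    have "norm (roe_trunc lam M m f dx (\<rho> * dx) i t x)
        \<le> (B * t powr (-2)) * (\<rho> * dx + dx + 2 * \<bar>lam i\<bar> * dx^2)"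
      using smooth bgk i t dx rho later[OF i t] by (intro roe_trunc_bound) auto
    also have "\<dots> \<le> (B * t powr (-2)) * ((\<rho> + 1 + 2 * L) * dx)"
    proof (rule mult_left_mono)
      have "\<bar>lam i\<bar> \<le> L" unfolding L_def using i by (intro member_le_sum) auto
      moreover have "dx^2 \<le> dx" using dx by (simp add: power2_eq_square mult_le_cancel_right1)
      ultimately have "\<bar>lam i\<bar> * dx^2 \<le> L * dx" by (intro mult_mono) auto
      then show "\<rho> * dx + dx + 2 * \<bar>lam i\<bar> * dx^2 \<le> (\<rho> + 1 + 2 * L) * dx" by (simp add: algebra_simps)
      show "0 \<le> B * t powr (-2)" using B by (simp add: B_def)
    qed
    finally show ?thesis by (simp add: mult_ac)
  qed
  then show ?thesis using C0 by blast
qed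

text \<open>Mapping bounded component vectors by a row of D costs at most the total operator norm.\<close>

lemma norm_block_row_le:
  fixes D :: "nat \<Rightarrow> nat \<Rightarrow> real^'k^'k" and v :: "nat \<Rightarrow> real^'k"
  assumes v: "\<forall>b<m. norm (v b) \<le> e" and a: "a < m"
  shows "norm (\<Sum>b<m. D a b *v v b) \<le> (\<Sum>a<m. \<Sum>b<m. onorm ((*v) (D a b))) * e"
proof -
  have onorm0: "0 \<le> onorm ((*v) (A::real^'k^'k))" for A
    by (rule onorm_pos_le[OF matrix_vector_mul_bounded_linear])
  have "norm (\<Sum>b<m. D a b *v v b) \<le> (\<Sum>b<m. onorm ((*v) (D a b)) * e)"
    using v by (intro norm_matrix_vector_sum_le) auto
  also have "\<dots> = (\<Sum>b<m. onorm ((*v) (D a b))) * e" by (simp add: sum_distrib_right)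
  also have "\<dots> \<le> (\<Sum>a<m. \<Sum>b<m. onorm ((*v) (D a b))) * e"
  proof (rule mult_right_mono)
    show "(\<Sum>b<m. onorm ((*v) (D a b))) \<le> (\<Sum>a<m. \<Sum>b<m. onorm ((*v) (D a b)))"
      using a onorm0 by (intro member_le_sum[where f="\<lambda>a. \<Sum>b<m. onorm ((*v) (D a b))"]) (auto intro: sum_nonneg)
    show "0 \<le> e" using v a by (meson norm_ge_zero order.trans)
  qed
  finally show ?thesis .
qed

text \<open>Main theorem: Z = D f has u = Z_0 by the first block row of D; the assumed decay rates
  give t^{-2} decay of Z_tt, Z_tx, Z_xxx, hence of the f^i, hence the truncation bound.\<close>

theorem mainTheorem4:
  fixes m :: nat
    and lam :: "nat \<Rightarrow> real"
    and M :: "nat \<Rightarrow> real^'k \<Rightarrow> real^'k"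
    and f :: "nat \<Rightarrow> real \<Rightarrow> real \<Rightarrow> real^'k"
    and D :: "nat \<Rightarrow> nat \<Rightarrow> real^'k^'k"
    and h :: "nat \<Rightarrow> real^'k^'k"
    and \<rho> :: real
  assumes m_pos: "0 < m"
    and rho_pos: "0 < \<rho>"
    \<comment> \<open>structure of D: first block row (I_k ... I_k), D^T D = diag(h_1,...,h_m)\<close>
    and D_first_row: "\<forall>b<m. D 0 b = mat 1"
    and DtD: "\<forall>b<m. \<forall>c<m. (\<Sum>a<m. transpose (D a b) ** D a c) = (if b = c then h b else 0)"
    and h_inv: "\<forall>b<m. invertible (h b)"
    \<comment> \<open>A_11 = sum_i lambda_i h_i^{-1} = 0\<close>
    and A11_zero: "(\<Sum>b<m. lam b *\<^sub>R matrix_inv (h b)) = 0"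
    \<comment> \<open>f is a smooth solution of the BGK system for t > 0\<close>
    and smooth: "\<forall>i<m. smooth_tx (f i)"
    and bgk: "\<forall>i<m. \<forall>t>0. \<forall>x. pdt (f i) t x + lam i *\<^sub>R pdx (f i) t x
                 = M i (\<Sum>l<m. f l t x) - f i t x"
    \<comment> \<open>decay estimates for Z = D f = (u, Z~) (block 0 is u, blocks 1..m-1 are Z~)\<close>
    and decay_Z: "\<forall>a<m. \<forall>\<beta>. \<exists>C. \<forall>t\<ge>1. \<forall>x.
        norm (pD 0 \<beta> (\<lambda>s y. \<Sum>b<m. D a b *v f b s y) t x) \<le> C * t powr (-1/2 - real \<beta> / 2)"
    and decay_Zt: "\<forall>a. 1 \<le> a \<and> a < m \<longrightarrow> (\<forall>\<beta>. \<exists>C. \<forall>t\<ge>1. \<forall>x.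
        norm (pD 0 \<beta> (\<lambda>s y. \<Sum>b<m. D a b *v f b s y) t x) \<le> C * t powr (-1 - real \<beta> / 2))"
    and decay_Z_t: "\<forall>a<m. \<forall>\<beta>. \<exists>C. \<forall>t\<ge>1. \<forall>x.
        norm (pD 1 \<beta> (\<lambda>s y. \<Sum>b<m. D a b *v f b s y) t x) \<le> C * t powr (-1 - real \<beta> / 2)"
    and decay_Zt_t: "\<forall>a. 1 \<le> a \<and> a < m \<longrightarrow> (\<forall>\<beta>. \<exists>C. \<forall>t\<ge>1. \<forall>x.
        norm (pD 1 \<beta> (\<lambda>s y. \<Sum>b<m. D a b *v f b s y) t x) \<le> C * t powr (-3/2 - real \<beta> / 2))"
    \<comment> \<open>additional decay available when A_11 = 0\<close>
    and decay_u_tt: "\<exists>C. \<forall>t\<ge>1. \<forall>x. norm (pD 2 0 (\<lambda>s y. \<Sum>b<m. f b s y) t x) \<le> C * t powr (-2)"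
    and decay_u_tx: "\<exists>C. \<forall>t\<ge>1. \<forall>x. norm (pD 1 1 (\<lambda>s y. \<Sum>b<m. f b s y) t x) \<le> C * t powr (-2)"
    and decay_Zt_t2: "\<forall>a. 1 \<le> a \<and> a < m \<longrightarrow> (\<exists>C. \<forall>t\<ge>1. \<forall>x.
        norm (pD 1 0 (\<lambda>s y. \<Sum>b<m. D a b *v f b s y) t x) \<le> C * t powr (-2))"
    and decay_Zt_tt: "\<forall>a. 1 \<le> a \<and> a < m \<longrightarrow> (\<exists>C. \<forall>t\<ge>1. \<forall>x.
        norm (pD 2 0 (\<lambda>s y. \<Sum>b<m. D a b *v f b s y) t x) \<le> C * t powr (-2))"
  shows "\<exists>C T0 dx0. 0 < dx0 \<and> (\<forall>dx. 0 < dx \<and> dx \<le> dx0 \<longrightarrow>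
           (\<forall>(n::nat) (j::int). real n * (\<rho> * dx) \<ge> T0 \<longrightarrow>
              (\<forall>a<m. norm (\<Sum>b<m. D a b *v
                   roe_trunc lam M m f dx (\<rho> * dx) b (real n * (\<rho> * dx)) (real_of_int j * dx))
                 \<le> C * (dx * (real n * (\<rho> * dx)) powr (-2)
                        + dx\<^sup>2 * (real n * (\<rho> * dx)) powr (-3/2)))))"
proof -
  define Z where "Z a = (\<lambda>s y. \<Sum>b<m. D a b *v f b s y)" for a
  have Z0: "Z 0 = (\<lambda>s y. \<Sum>b<m. f b s y)"
    using D_first_row by (auto simp: Z_def intro!: ext sum.cong)
  have Z_decay: "decays 2 0 (-2) (Z a) \<and> decays 1 1 (-2) (Z a) \<and> decays 0 3 (-2) (Z a)" if a: "a < m" for a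
  proof (cases "a = 0")
    case True
    then show ?thesis using decay_u_tt decay_u_tx decay_Z[rule_format, OF a, of 3] Z0
      by (simp add: decays_def Z_def)
  next
    case False
    then show ?thesis using decay_Zt_tt decay_Zt_t[rule_format, of a 1] decay_Z[rule_format, OF a, of 3] a
      by (simp add: decays_def Z_def)
  qed
  have f_decay: "\<forall>i<m. decays 2 0 (-2) (f i) \<and> decays 1 1 (-2) (f i) \<and> decays 0 3 (-2) (f i)"
    using components_decay[OF DtD h_inv smooth] Z_decay unfolding Z_def by blast
  obtain C where C0: "0 \<le> C" and trunc: "\<forall>i<m. \<forall>dx t x. 0 < dx \<longrightarrow> dx \<le> 1 \<longrightarrow> 1 \<le> t \<longrightarrow>
      norm (roe_trunc lam M m f dx (\<rho> * dx) i t x) \<le> C * (dx * t powr (-2))"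
    using roe_truncation_decay[OF smooth bgk f_decay rho_pos] by blast
  define N where "N = (\<Sum>a<m. \<Sum>b<m. onorm ((*v) (D a b)))"
  have N0: "0 \<le> N" unfolding N_def by (intro sum_nonneg onorm_pos_le[OF matrix_vector_mul_bounded_linear])
  have "norm (\<Sum>b<m. D a b *v roe_trunc lam M m f dx (\<rho> * dx) b t x)
      \<le> N * C * (dx * t powr (-2) + dx\<^sup>2 * t powr (-3/2))"
    if "0 < dx" "dx \<le> 1" "1 \<le> t" "a < m" for dx t x a
  proof -
    have "norm (\<Sum>b<m. D a b *v roe_trunc lam M m f dx (\<rho> * dx) b t x) \<le> N * (C * (dx * t powr (-2)))"
      unfolding N_def using trunc that by (intro norm_block_row_le) auto
    also have "\<dots> \<le> N * C * (dx * t powr (-2) + dx\<^sup>2 * t powr (-3/2))"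
      using N0 C0 by (simp add: mult.assoc mult_left_mono)
    finally show ?thesis .
  qed
  then show ?thesis by (intro exI[of _ "N * C"] exI[of _ 1] exI[of _ 1]) auto
qed

end
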